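(* Assume $0\le\alpha<\beta$ and $\alpha+\beta<2$. Then, under $\mu_{N,\alpha,\beta,S}$, the vector $\sqrt N\,(m_1,m_2)$ converges in distribution as $N\to\infty$ to a centered two-dimensional Gaussian random vector with covariance matrix \[ \Sigma=s^2\begin{pmatrix}1&r\\ r&1\end{pmatrix},\qquad s^2=\frac{8-4\beta}{(2-\beta)^2-\alpha^2},\qquad r=\frac{\alpha}{2-\beta}. \]
   Context: Block spin Ising model: $N$ is even, $S\subset\{1,\dots,N\}$ with $|S|=N/2$. Write $i\sim j$ if $i,j$ both lie in $S$ or both in $S^c$, $i\not\sim j$ otherwise. Hamiltonian $H_{N,\alpha,\beta,S}(\sigma)=-\frac{\beta}{2N}\sum_{i\sim j}\sigma_i\sigma_j-\frac{\alpha}{2N}\sum_{i\not\sim j}\sigma_i\sigma_j$ on $\{-1,+1\}^N$ (ordered pairs, including $i=j$), Gibbs measure $\mu_{N,\alpha,\beta,S}(\sigma)\propto e^{-H_{N,\alpha,\beta,S}(\sigma)}$. Block magnetizations $m_1=\frac2N\sum_{i\in S}\sigma_i$, $m_2=\frac2N\sum_{i\notin S}\sigma_i$. *)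

theory Defs
  imports "HOL-Analysis.Analysis"
begin

text \<open>Spin configurations on sites 1..N (values outside are irrelevant; PiE makes them undefined).\<close>
definition spin_configs :: "nat \<Rightarrow> (nat \<Rightarrow> real) set" where
  "spin_configs N = PiE {1..N} (\<lambda>_. {-1, 1})"

definition block_H :: "nat \<Rightarrow> real \<Rightarrow> real \<Rightarrow> nat set \<Rightarrow> (nat \<Rightarrow> real) \<Rightarrow> real" where
  "block_H N \<alpha> \<beta> S \<sigma> =
     - (\<beta> / (2 * real N)) * (\<Sum>i\<in>{1..N}. \<Sum>j\<in>{1..N}.
            if (i \<in> S \<longleftrightarrow> j \<in> S) then \<sigma> i * \<sigma> j else 0)
     - (\<alpha> / (2 * real N)) * (\<Sum>i\<in>{1..N}. \<Sum>j\<in>{1..N}.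
            if (i \<in> S \<longleftrightarrow> j \<in> S) then 0 else \<sigma> i * \<sigma> j)"

definition partition_fn :: "nat \<Rightarrow> real \<Rightarrow> real \<Rightarrow> nat set \<Rightarrow> real" where
  "partition_fn N \<alpha> \<beta> S = (\<Sum>\<sigma>\<in>spin_configs N. exp (- block_H N \<alpha> \<beta> S \<sigma>))"

definition gibbs :: "nat \<Rightarrow> real \<Rightarrow> real \<Rightarrow> nat set \<Rightarrow> (nat \<Rightarrow> real) \<Rightarrow> real" where
  "gibbs N \<alpha> \<beta> S \<sigma> = exp (- block_H N \<alpha> \<beta> S \<sigma>) / partition_fn N \<alpha> \<beta> S"

definition mag1 :: "nat \<Rightarrow> nat set \<Rightarrow> (nat \<Rightarrow> real) \<Rightarrow> real" where
  "mag1 N S \<sigma> = (2 / real N) * (\<Sum>i\<in>{1..N} \<inter> S. \<sigma> i)"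

definition mag2 :: "nat \<Rightarrow> nat set \<Rightarrow> (nat \<Rightarrow> real) \<Rightarrow> real" where
  "mag2 N S \<sigma> = (2 / real N) * (\<Sum>i\<in>{1..N} - S. \<sigma> i)"

definition scaled_mag_expect ::
  "nat \<Rightarrow> real \<Rightarrow> real \<Rightarrow> nat set \<Rightarrow> (real \<times> real \<Rightarrow> real) \<Rightarrow> real" where
  "scaled_mag_expect N \<alpha> \<beta> S f =
     (\<Sum>\<sigma>\<in>spin_configs N. gibbs N \<alpha> \<beta> S \<sigma> *
        f (sqrt (real N) * mag1 N S \<sigma>, sqrt (real N) * mag2 N S \<sigma>))"

text \<open>Density of a centered bivariate Gaussian with covariance s2 * [[1, r], [r, 1]]
  (s2 > 0, |r| < 1).\<close>
definition gauss2_density :: "real \<Rightarrow> real \<Rightarrow> real \<times> real \<Rightarrow> real" where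
  "gauss2_density s2 r = (\<lambda>(x, y).
     exp (- (x\<^sup>2 - 2 * r * x * y + y\<^sup>2) / (2 * s2 * (1 - r\<^sup>2)))
       / (2 * pi * s2 * sqrt (1 - r\<^sup>2)))"

definition gauss2 :: "real \<Rightarrow> real \<Rightarrow> (real \<times> real) measure" where
  "gauss2 s2 r = density lborel (\<lambda>z. ennreal (gauss2_density s2 r z))"

definition converges_in_distribution ::
  "(nat \<Rightarrow> (real \<times> real \<Rightarrow> real) \<Rightarrow> real) \<Rightarrow> (real \<times> real) measure \<Rightarrow> bool" where
  "converges_in_distribution E M \<longleftrightarrow>
     (\<forall>f. continuous_on UNIV f \<and> bounded (range f) \<longrightarrow>
        (\<lambda>n. E n f) \<longlonglongrightarrow> integral\<^sup>L M f)"

end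

theory Submission
  imports Defs "HOL-Probability.Probability" "HOL-Real_Asymp.Real_Asymp"
begin

text \<open>
  Put \<open>N = 2n\<close>. Under the uniform measure on configurations the two coordinates of
  \<open>\<surd>N (m\<^sub>1, m\<^sub>2)\<close> are independent, each being \<open>\<surd>(2/n)\<close> times a sum of \<open>n\<close> fair signs, and
  converge to the normal law of variance 2. The Gibbs measure is obtained by reweighting with
  \<open>exp (\<beta>/8 (x\<^sup>2 + y\<^sup>2) + \<alpha>/4 x y) \<le> exp (c (x\<^sup>2 + y\<^sup>2) / 4)\<close>, where \<open>c = (\<alpha> + \<beta>)/2 < 1\<close>.
  The sums of signs satisfy \<open>E exp (s X\<^sup>2 / 4) \<le> 1 / \<surd>(1 - s)\<close> uniformly in \<open>n\<close> for
  \<open>s < 1\<close>, so the weights are bounded in some \<open>L\<^sup>p\<close> with \<open>p > 1\<close>, hence uniformly integrable.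
  Coupling each coordinate with its limit by Skorohod's theorem, the reweighted expectations
  converge to those under the product normal law, and the reweighted limit density is a
  multiple of the claimed bivariate Gaussian density.
\<close>

section \<open>Scalar estimates for a fair sign\<close>

text \<open>The central limit theorem in Fourier form: the left side is the characteristic function
  of \<open>sqrt (2 / n)\<close> times a sum of \<open>n\<close> fair signs, the right side that of
  the centered normal law of variance 2.\<close>

lemma tendsto_cos_power: "(\<lambda>n::nat. cos (t * sqrt (2 / real n)) ^ n) \<longlonglongrightarrow> exp (- t\<^sup>2)"
proof -
  have "(\<lambda>n::nat. cos (s / sqrt (real n)) ^ n) \<longlonglongrightarrow> exp (- (s * s / 2))" for s :: real
    by real_asymp
  from this[of "t * sqrt 2"] have "(\<lambda>n::nat. cos (t * sqrt 2 / sqrt (real n)) ^ n) \<longlonglongrightarrow> exp (- t\<^sup>2)"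
    by (simp add: power_mult_distrib flip: power2_eq_square)
  then show ?thesis
    by (simp add: real_sqrt_divide)
qed

text \<open>Hoeffding's lemma for a fair sign, taken with \<open>h = 2 * t\<close> and probability
  \<open>1/2\<close>: after factoring out \<open>exp (-t)\<close>, a variable on 0 and
  \<open>2 * t\<close> becomes a sign scaled by \<open>t\<close>. The bound is applied for
  \<open>t \<ge> 0\<close>; evenness of \<open>cosh\<close> gives the rest.\<close>

lemma cosh_le_exp_half_square: "cosh t \<le> exp (t\<^sup>2 / 2)" for t :: real
proof -
  have *: "cosh t \<le> exp (t\<^sup>2 / 2)" if "t \<ge> 0" for t :: real
  proof -
    have "- (2*t) * (1/2) + ln (1 + (1/2) * (exp (2*t) - 1)) \<le> (2*t)\<^sup>2 / 8"
      using that by (intro Hoeffdings_lemma_aux) auto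
    hence "ln (1 + (1/2) * (exp (2*t) - 1)) \<le> t + t\<^sup>2/2"
      by (simp add: power2_eq_square)
    moreover have pos: "1 + (1/2) * (exp (2*t) - 1) > 0"
      by (simp add: add_pos_pos field_simps)
    ultimately have "1 + (1/2) * (exp (2*t) - 1) \<le> exp (t + t\<^sup>2/2)"
      by (metis exp_le_cancel_iff exp_ln)
    hence "exp (-t) * (1 + (1/2) * (exp (2*t) - 1)) \<le> exp (-t) * exp (t + t\<^sup>2/2)"
      by (intro mult_left_mono) auto
    also have "exp (-t) * exp (t + t\<^sup>2/2) = exp (t\<^sup>2/2)"
      by (simp flip: exp_add)
    also have "exp (-t) * (1 + (1/2) * (exp (2*t) - 1)) = cosh t"
      by (simp add: cosh_def algebra_simps flip: exp_add)
    finally show ?thesis .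
  qed
  show ?thesis using *[of t] *[of "-t"] by (cases "t \<ge> 0") auto
qed

section \<open>Law of a normalised sum of fair signs\<close>

text \<open>One coordinate of the scaled magnetization under uniform spins: for a block of
  \<open>n\<close> sites out of \<open>N = 2 * n\<close>, the factor \<open>sqrt N * (2 / N)\<close>
  equals \<open>sqrt (2 / n)\<close>.\<close>

definition spin_sum_law :: "'i set \<Rightarrow> real measure" where
  "spin_sum_law A = distr (uniform_count_measure (PiE A (\<lambda>_. {-1, 1}))) borel
     (\<lambda>\<sigma>. sqrt (2 / real (card A)) * (\<Sum>i\<in>A. \<sigma> i))"

lemma card_spins: "finite A \<Longrightarrow> card (PiE A (\<lambda>_. {-1, 1::real})) = 2 ^ card A"
  by (simp add: card_PiE numeral_2_eq_2)

lemma finite_spins: "finite A \<Longrightarrow> finite (PiE A (\<lambda>_. {-1, 1::real}))"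
  by (intro finite_PiE) auto

lemma spins_nonempty: "PiE A (\<lambda>_. {-1, 1::real}) \<noteq> {}"
  by (auto simp: PiE_eq_empty_iff)

lemma real_distribution_spin_sum_law:
  assumes "finite A" shows "real_distribution (spin_sum_law A)"
  unfolding spin_sum_law_def
  by (intro prob_space.real_distribution_distr prob_space_uniform_count_measure finite_spins
      spins_nonempty assms) (auto simp: uniform_count_measure_def)

text \<open>The exponential of a sum factorises over independent spins. A real \<open>z\<close>
  yields the moment generating function and an imaginary \<open>z\<close> the characteristic
  function, hence the general field.\<close>

lemma sum_exp_spins:
  fixes z :: "'b :: {real_normed_field, banach}"
  assumes "finite A"
  shows "(\<Sum>\<sigma>\<in>PiE A (\<lambda>_. {-1, 1::real}). exp (z * of_real (\<Sum>i\<in>A. \<sigma> i))) / 2 ^ card A = cosh z ^ card A"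
proof -
  have "(\<Sum>\<sigma>\<in>PiE A (\<lambda>_. {-1, 1::real}). exp (z * of_real (\<Sum>i\<in>A. \<sigma> i)))
      = (\<Sum>\<sigma>\<in>PiE A (\<lambda>_. {-1, 1::real}). \<Prod>i\<in>A. exp (z * of_real (\<sigma> i)))"
    using assms by (simp add: exp_sum sum_distrib_left)
  also have "\<dots> = (\<Prod>i\<in>A. \<Sum>y\<in>{-1,1::real}. exp (z * of_real y))"
    using assms by (subst prod_sum_PiE) auto
  also have "\<dots> = (exp z + exp (- z)) ^ card A"
    by (simp add: add.commute)
  also have "exp z + exp (- z) = 2 * cosh z"
    by (simp add: cosh_def scaleR_conv_of_real)
  finally show ?thesis by (simp add: power_mult_distrib)
qed

lemma integral_spin_sum_law:
  fixes f :: "real \<Rightarrow> 'b :: {banach, second_countable_topology}"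
  assumes "finite A" "f \<in> borel_measurable borel"
  shows "integral\<^sup>L (spin_sum_law A) f =
    (\<Sum>\<sigma>\<in>PiE A (\<lambda>_. {-1, 1}). f (sqrt (2 / real (card A)) * (\<Sum>i\<in>A. \<sigma> i))) /\<^sub>R 2 ^ card A"
  unfolding spin_sum_law_def using assms
  by (subst integral_distr)
     (auto simp: uniform_count_measure_def
        lebesgue_integral_point_measure_finite card_spins finite_spins scaleR_sum_right divide_inverse)

lemma char_spin_sum_law:
  assumes "finite A"
  shows "char (spin_sum_law A) t = complex_of_real (cos (t * sqrt (2 / real (card A))) ^ card A)"
proof -
  let ?s = "t * sqrt (2 / real (card A))"
  have "char (spin_sum_law A) t = (\<Sum>\<sigma>\<in>PiE A (\<lambda>_. {-1, 1}).
     exp ((\<i> * ?s) * of_real (\<Sum>i\<in>A. \<sigma> i))) / 2 ^ card A"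
    using assms unfolding char_def
    by (subst integral_spin_sum_law) (auto simp: scaleR_conv_of_real mult_ac divide_inverse)
  also have "\<dots> = cosh (\<i> * complex_of_real ?s) ^ card A"
    using assms by (subst sum_exp_spins) auto
  also have "cosh (\<i> * complex_of_real ?s) = cos (complex_of_real ?s)"
    by (simp add: cosh_conv_cos)
  also have "\<dots> = complex_of_real (cos ?s)" by (rule cos_of_real)
  finally show ?thesis by simp
qed

section \<open>Gaussian integrals and exponential square moments\<close>

text \<open>Completing the square: the factor \<open>exp (b * g)\<close> moves the mean of the
  density to \<open>b\<close>.\<close>

lemma integral_exp_std_normal:
  "(\<integral>g. exp (b * g) * std_normal_density g \<partial>lborel) = exp (b\<^sup>2 / 2)"
  "integrable lborel (\<lambda>g. exp (b * g) * std_normal_density g)"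
proof -
  have *: "exp (b * g) * std_normal_density g = exp (b\<^sup>2 / 2) * normal_density b 1 g" for g
  proof -
    have "b * g + - g\<^sup>2 / 2 = b\<^sup>2/2 + - (g - b)\<^sup>2 / 2"
      by (simp add: field_simps power2_eq_square)
    then show ?thesis
      by (simp add: normal_density_def flip: exp_add)
  qed
  show "(\<integral>g. exp (b * g) * std_normal_density g \<partial>lborel) = exp (b\<^sup>2 / 2)"
    unfolding * by simp
  show "integrable lborel (\<lambda>g. exp (b * g) * std_normal_density g)"
    unfolding * by simp
qed

text \<open>The factor \<open>exp (s * g^2 / 2)\<close> changes the variance from 1 to
  \<open>1 / (1 - s)\<close>, which is positive as \<open>s < 1\<close>; the integral is the ratio
  of the normalising constants.\<close>

lemma integral_exp_square_normal:
  assumes "s < 1"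
  shows "(\<integral>g. exp (s * g\<^sup>2 / 2) * std_normal_density g \<partial>lborel) = 1 / sqrt (1 - s)"
    and "integrable lborel (\<lambda>g. exp (s * g\<^sup>2 / 2) * std_normal_density g)"
proof -
  define u where "u = 1 / sqrt (1 - s)"
  have u: "u > 0" "u\<^sup>2 = 1 / (1 - s)" using assms by (auto simp: u_def power_divide)
  have *: "exp (s * g\<^sup>2 / 2) * std_normal_density g = u * normal_density 0 u g" for g
  proof -
    have "s * g\<^sup>2 / 2 + - g\<^sup>2 / 2 = - g\<^sup>2 / (2 * u\<^sup>2)"
      using assms by (simp add: u(2) field_simps)
    moreover have "u / sqrt (2 * pi * u\<^sup>2) = 1 / sqrt (2 * pi)"
      using u(1) by (simp add: real_sqrt_mult)
    moreover have "u * normal_density 0 u g = u / sqrt (2 * pi * u\<^sup>2) * exp (- g\<^sup>2 / (2 * u\<^sup>2))"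
      by (simp add: normal_density_def)
    ultimately show ?thesis
      by (simp add: normal_density_def flip: exp_add)
  qed
  show "(\<integral>g. exp (s * g\<^sup>2 / 2) * std_normal_density g \<partial>lborel) = 1 / sqrt (1 - s)"
    unfolding * using u by (simp flip: u_def)
  show "integrable lborel (\<lambda>g. exp (s * g\<^sup>2 / 2) * std_normal_density g)"
    unfolding * using u by simp
qed

text \<open>Once the square is linearised, the sub-Gaussian bound \<open>mgf\<close> at
  \<open>u = sqrt (s / 2) * g\<close> replaces the spins by a Gaussian integral. The resulting bound
  does not depend on \<open>A\<close>, which is what uniform integrability requires.\<close>

lemma spin_sum_law_exp_square_bound:
  assumes "finite A" "0 \<le> s" "s < 1"
  shows "(\<integral>x. exp (s * x\<^sup>2 / 4) \<partial>spin_sum_law A) \<le> 1 / sqrt (1 - s)"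
proof -
  let ?P = "PiE A (\<lambda>_. {-1, 1::real})"
  let ?n = "card A"
  define X where "X = (\<lambda>\<sigma>. sqrt (2 / real ?n) * (\<Sum>i\<in>A. \<sigma> i :: real))"
  have mgf: "(\<Sum>\<sigma>\<in>?P. exp (u * X \<sigma>)) / 2 ^ ?n \<le> exp (u\<^sup>2)" for u
  proof -
    have "(\<Sum>\<sigma>\<in>?P. exp (u * X \<sigma>)) / 2 ^ ?n = cosh (u * sqrt (2 / real ?n)) ^ ?n"
      using sum_exp_spins[OF assms(1), of "u * sqrt (2 / real ?n)"]
      by (simp add: X_def mult_ac)
    also have "\<dots> \<le> exp ((u * sqrt (2 / real ?n))\<^sup>2 / 2) ^ ?n"
      by (intro power_mono cosh_le_exp_half_square) auto
    also have "\<dots> = exp (real ?n * ((u * sqrt (2 / real ?n))\<^sup>2 / 2))"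
      by (rule exp_of_nat_mult [symmetric])
    \<comment> \<open>Equality for \<open>?n > 0\<close>; for \<open>?n = 0\<close> the left side is
      \<open>exp 0\<close>.\<close>
    also have "\<dots> \<le> exp (u\<^sup>2)"
      by (cases "?n = 0") (auto simp: power_mult_distrib)
    finally show ?thesis .
  qed
  \<comment> \<open>Hubbard-Stratonovich: a Gaussian average linearises the square.\<close>
  have lin: "exp (s * (X \<sigma>)\<^sup>2 / 4) = (\<integral>g. exp (sqrt (s / 2) * X \<sigma> * g) * std_normal_density g \<partial>lborel)" for \<sigma>
    using assms by (subst integral_exp_std_normal) (auto simp: power_mult_distrib)
  have "(\<integral>x. exp (s * x\<^sup>2 / 4) \<partial>spin_sum_law A) = (\<Sum>\<sigma>\<in>?P. exp (s * (X \<sigma>)\<^sup>2 / 4)) /\<^sub>R 2 ^ ?n"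
    unfolding X_def by (rule integral_spin_sum_law) (use assms(1) in measurable)
  also have "\<dots> = (\<Sum>\<sigma>\<in>?P. exp (s * (X \<sigma>)\<^sup>2 / 4)) / 2 ^ ?n"
    by (simp only: real_scaleR_def divide_inverse mult.commute)
  also have "\<dots> = (\<integral>g. (\<Sum>\<sigma>\<in>?P. exp (sqrt (s / 2) * X \<sigma> * g) * std_normal_density g) / 2 ^ ?n \<partial>lborel)"
    unfolding lin by (simp add: integral_exp_std_normal(2))
  also have "\<dots> \<le> (\<integral>g. exp (s * g\<^sup>2 / 2) * std_normal_density g \<partial>lborel)"
  proof (rule integral_mono)
    fix g :: real
    have "(\<Sum>\<sigma>\<in>?P. exp (sqrt (s / 2) * X \<sigma> * g) * std_normal_density g) / 2 ^ ?n
      = (\<Sum>\<sigma>\<in>?P. exp ((sqrt (s / 2) * g) * X \<sigma>)) / 2 ^ ?n * std_normal_density g"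
      by (simp only: sum_distrib_right sum_divide_distrib times_divide_eq_left times_divide_eq_right
          sum_distrib_left mult_ac)
    also have "\<dots> \<le> exp ((sqrt (s / 2) * g)\<^sup>2) * std_normal_density g"
      by (intro mult_right_mono mgf) auto
    also have "(sqrt (s / 2) * g)\<^sup>2 = s * g\<^sup>2 / 2"
      using assms by (simp add: power_mult_distrib)
    finally show "(\<Sum>\<sigma>\<in>?P. exp (sqrt (s / 2) * X \<sigma> * g) * std_normal_density g) / 2 ^ ?n
        \<le> exp (s * g\<^sup>2 / 2) * std_normal_density g" .
  qed (use assms in \<open>auto intro!: integral_exp_square_normal integral_exp_std_normal\<close>)
  also have "\<dots> = 1 / sqrt (1 - s)"
    using assms(3) by (rule integral_exp_square_normal)
  finally show ?thesis .
qed

section \<open>Central limit theorem for one block\<close>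

abbreviation normal2 :: "real measure" where
  "normal2 \<equiv> density lborel (\<lambda>x. ennreal (normal_density 0 (sqrt 2) x))"

lemma distr_std_normal_sqrt2: "distr std_normal_distribution borel (\<lambda>x. sqrt 2 * x) = normal2"
proof -
  interpret real_distribution std_normal_distribution by (rule real_dist_normal_dist)
  have "distributed std_normal_distribution lborel (\<lambda>x. x) (normal_density 0 1)"
    by (auto simp: distributed_def distr_id2)
  from normal_density_affine[OF this, of "sqrt 2" 0]
  have "distr std_normal_distribution lborel (\<lambda>x. sqrt 2 * x) = normal2"
    by (simp add: distributed_def)
  also have "distr std_normal_distribution lborel (\<lambda>x. sqrt 2 * x) = distr std_normal_distribution borel (\<lambda>x. sqrt 2 * x)"
    by (rule distr_cong) auto
  finally show ?thesis .
qed

lemma real_distribution_normal2: "real_distribution normal2"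
  by (auto simp: real_distribution_def real_distribution_axioms_def prob_space_normal_density)

lemma char_normal2: "char normal2 t = complex_of_real (exp (- t\<^sup>2))"
proof -
  have "char normal2 t = char std_normal_distribution (t * sqrt 2)"
    unfolding distr_std_normal_sqrt2[symmetric] char_def
    by (subst integral_distr) (auto simp: mult_ac)
  also have "\<dots> = complex_of_real (exp (- t\<^sup>2))"
    by (simp add: char_std_normal_distribution power_mult_distrib)
  finally show ?thesis .
qed

text \<open>Levy's continuity theorem. The characteristic function depends on \<open>A n\<close>
  through its cardinality alone, so the sets may vary arbitrarily with \<open>n\<close>.\<close>

lemma weak_conv_spin_sum_law:
  assumes "\<And>n. finite (A n)" "\<And>n. card (A n) = n"
  shows "weak_conv_m (\<lambda>n. spin_sum_law (A n)) normal2"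
proof (rule levy_continuity)
  fix t show "(\<lambda>n. char (spin_sum_law (A n)) t) \<longlonglongrightarrow> char normal2 t"
    unfolding char_spin_sum_law[OF assms(1)] assms(2) char_normal2
    by (intro tendsto_of_real tendsto_cos_power)
qed (auto intro: real_distribution_spin_sum_law real_distribution_normal2 assms)

section \<open>Convergence of integrals under a moment bound\<close>

text \<open>The error vanishes for \<open>\<bar>y\<bar> \<le> K\<close>. Beyond \<open>K\<close> it
  is at most \<open>\<bar>y\<bar>\<close>, and the negative exponent \<open>1 - p\<close> lets
  \<open>\<bar>y\<bar> powr (1 - p)\<close> be replaced by its value at \<open>K\<close>.\<close>

lemma truncation_error:
  fixes y K p :: real
  assumes "K > 0" "p > 1"
  shows "\<bar>y - max (- K) (min K y)\<bar> \<le> K powr (1 - p) * \<bar>y\<bar> powr p"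
proof (cases "\<bar>y\<bar> \<le> K")
  case True
  then have "max (- K) (min K y) = y" by (auto simp: max_def min_def)
  then show ?thesis by simp
next
  case False
  then have "\<bar>y - max (- K) (min K y)\<bar> \<le> \<bar>y\<bar>"
    using assms by (auto simp: max_def min_def)
  also have "\<bar>y\<bar> = \<bar>y\<bar> powr (1 - p) * \<bar>y\<bar> powr p"
    using False assms by (simp flip: powr_add)
  also have "\<dots> \<le> K powr (1 - p) * \<bar>y\<bar> powr p"
    using False assms by (intro mult_right_mono powr_mono2') auto
  finally show ?thesis .
qed

text \<open>A Vitali-type theorem: bounded moments of order \<open>p > 1\<close> give uniform
  integrability. Truncating at level \<open>k\<close> leaves three errors, each below
  \<open>e / 3\<close>: for \<open>g'\<close> by dominated convergence, for \<open>g n\<close> by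
  the moment bound uniformly in \<open>n\<close>, and between the truncated functions by bounded
  convergence at fixed \<open>k\<close>.\<close>

lemma (in prob_space) tendsto_integral_bounded_moment:
  fixes g :: "nat \<Rightarrow> 'a \<Rightarrow> real" and g' :: "'a \<Rightarrow> real"
  assumes int_g: "\<And>n. integrable M (g n)" and int_g': "integrable M g'"
    and lim: "\<And>x. x \<in> space M \<Longrightarrow> (\<lambda>n. g n x) \<longlonglongrightarrow> g' x"
    and p: "p > 1"
    and int_w: "\<And>n. integrable M (w n)" and w: "\<And>n. (\<integral>x. w n x \<partial>M) \<le> B"
    and le: "\<And>n x. x \<in> space M \<Longrightarrow> \<bar>g n x\<bar> powr p \<le> w n x"
  shows "(\<lambda>n. \<integral>x. g n x \<partial>M) \<longlonglongrightarrow> (\<integral>x. g' x \<partial>M)"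
proof (rule LIMSEQ_I)
  fix e :: real assume e: "e > 0"
  define T :: "real \<Rightarrow> real \<Rightarrow> real" where "T = (\<lambda>K y. max (- K) (min K y))"
  have [measurable]: "g n \<in> borel_measurable M" "g' \<in> borel_measurable M" for n
    using int_g int_g' by auto
  have T_meas [measurable]: "T K \<in> borel_measurable borel" for K
    unfolding T_def by measurable
  have T_bound: "\<bar>T K y\<bar> \<le> K" if "K \<ge> 0" for K y
    using that by (auto simp: T_def)
  have int_T: "integrable M (\<lambda>x. T K (h x))" if [measurable]: "h \<in> borel_measurable M" and "K \<ge> 0" for K h
    using that by (intro integrable_const_bound[of _ K]) (auto intro!: T_bound)
  have "(\<lambda>k. \<integral>x. T (real k) (g' x) \<partial>M) \<longlonglongrightarrow> (\<integral>x. g' x \<partial>M)"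
  proof (rule integral_dominated_convergence[where w = "\<lambda>x. \<bar>g' x\<bar>"])
    show "AE x in M. (\<lambda>k. T (real k) (g' x)) \<longlonglongrightarrow> g' x"
    proof (intro AE_I2 tendsto_eventually)
      fix x
      obtain k0 :: nat where "\<bar>g' x\<bar> \<le> real k0" using real_arch_simple by blast
      then show "\<forall>\<^sub>F k in sequentially. T (real k) (g' x) = g' x"
        by (intro eventually_sequentiallyI[of k0]) (auto simp: T_def max_def min_def)
    qed
  qed (use int_g' in \<open>auto simp: T_def\<close>)
  then have ev1: "\<forall>\<^sub>F k in sequentially. \<bar>(\<integral>x. T (real k) (g' x) \<partial>M) - (\<integral>x. g' x \<partial>M)\<bar> < e / 3"
    using e by (intro order_tendstoD tendsto_eq_intros | simp)+
  have "(\<lambda>k. real k powr (1 - p) * B) \<longlonglongrightarrow> 0"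
    using p by (intro tendsto_mult_left_zero tendsto_neg_powr filterlim_real_sequentially) auto
  then have ev2: "\<forall>\<^sub>F k in sequentially. real k powr (1 - p) * B < e / 3"
    using e by (intro order_tendstoD(2)) auto
  \<comment> \<open>The level is fixed before \<open>n\<close>, so that both truncation errors are
    already small when the truncated integrals are sent to their limit.\<close>
  obtain k where k: "k > 0" "\<bar>(\<integral>x. T (real k) (g' x) \<partial>M) - (\<integral>x. g' x \<partial>M)\<bar> < e / 3"
      "real k powr (1 - p) * B < e / 3"
    using eventually_happens[OF eventually_conj[OF eventually_gt_at_top[of 0] eventually_conj[OF ev1 ev2]]] by auto
  have "(\<lambda>n. \<integral>x. T (real k) (g n x) \<partial>M) \<longlonglongrightarrow> (\<integral>x. T (real k) (g' x) \<partial>M)"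
  proof (rule integral_dominated_convergence[where w = "\<lambda>_. real k"])
    show "AE x in M. (\<lambda>n. T (real k) (g n x)) \<longlonglongrightarrow> T (real k) (g' x)"
      unfolding T_def by (intro AE_I2 tendsto_intros lim)
  qed (auto intro!: T_bound)
  then obtain n0 where n0: "\<And>n. n \<ge> n0 \<Longrightarrow>
      \<bar>(\<integral>x. T (real k) (g n x) \<partial>M) - (\<integral>x. T (real k) (g' x) \<partial>M)\<bar> < e / 3"
    using LIMSEQ_D[of _ _ "e / 3"] e by (metis real_norm_def divide_pos_pos zero_less_numeral)
  have trunc: "\<bar>(\<integral>x. g n x \<partial>M) - (\<integral>x. T (real k) (g n x) \<partial>M)\<bar> < e / 3" for n
  proof -
    have "\<bar>(\<integral>x. g n x \<partial>M) - (\<integral>x. T (real k) (g n x) \<partial>M)\<bar> = \<bar>\<integral>x. g n x - T (real k) (g n x) \<partial>M\<bar>"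
      using int_g int_T by simp
    also have "\<dots> \<le> (\<integral>x. \<bar>g n x - T (real k) (g n x)\<bar> \<partial>M)"
      by (rule integral_abs_bound)
    also have "\<dots> \<le> (\<integral>x. real k powr (1 - p) * w n x \<partial>M)"
    proof (rule integral_mono)
      fix x assume x: "x \<in> space M"
      have "\<bar>g n x - T (real k) (g n x)\<bar> \<le> real k powr (1 - p) * \<bar>g n x\<bar> powr p"
        unfolding T_def using k p by (intro truncation_error) auto
      also have "\<dots> \<le> real k powr (1 - p) * w n x"
        using le[OF x] by (intro mult_left_mono) auto
      finally show "\<bar>g n x - T (real k) (g n x)\<bar> \<le> real k powr (1 - p) * w n x" .
    qed (use int_g int_T int_w in auto)
    also have "\<dots> = real k powr (1 - p) * (\<integral>x. w n x \<partial>M)"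
      by simp
    also have "\<dots> \<le> real k powr (1 - p) * B"
      using w by (intro mult_left_mono) auto
    finally show ?thesis using k by simp
  qed
  show "\<exists>n0. \<forall>n\<ge>n0. norm ((\<integral>x. g n x \<partial>M) - (\<integral>x. g' x \<partial>M)) < e"
  proof (intro exI[of _ n0] allI impI)
    fix n assume "n \<ge> n0"
    from n0[OF this] trunc[of n] k(2) show "norm ((\<integral>x. g n x \<partial>M) - (\<integral>x. g' x \<partial>M)) < e"
      by (simp only: abs_less_iff real_norm_def) linarith
  qed
qed

section \<open>Independent pairs of block sums\<close>

text \<open>The pair law is the image of the uniform measure on pairs of configurations. That set is
  finite, so integrals are finite averages and any measurable \<open>F\<close> is integrable,
  whatever its growth.\<close>

lemma pair_spin_sum_law:
  fixes F :: "real \<times> real \<Rightarrow> real"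
  assumes "finite A" "finite B" and [measurable]: "F \<in> borel_measurable (borel \<Otimes>\<^sub>M borel)"
  shows "integrable (spin_sum_law A \<Otimes>\<^sub>M spin_sum_law B) F"
    and "(\<integral>z. F z \<partial>(spin_sum_law A \<Otimes>\<^sub>M spin_sum_law B)) =
      (\<Sum>\<sigma>\<in>PiE A (\<lambda>_. {-1, 1}). \<Sum>\<tau>\<in>PiE B (\<lambda>_. {-1, 1}).
         F (sqrt (2 / real (card A)) * (\<Sum>i\<in>A. \<sigma> i), sqrt (2 / real (card B)) * (\<Sum>i\<in>B. \<tau> i)))
       / 2 ^ (card A + card B)"
proof -
  let ?PA = "PiE A (\<lambda>_. {-1, 1::real})" and ?PB = "PiE B (\<lambda>_. {-1, 1::real})"
  define X where "X = (\<lambda>\<sigma>. sqrt (2 / real (card A)) * (\<Sum>i\<in>A. \<sigma> i :: real))"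
  define Y where "Y = (\<lambda>\<tau>. sqrt (2 / real (card B)) * (\<Sum>i\<in>B. \<tau> i :: real))"
  let ?Z = "\<lambda>(x, y). (X x, Y y)"
  have fin: "finite ?PA" "finite ?PB" using assms finite_spins by auto
  have cards: "card ?PA = 2 ^ card A" "card ?PB = 2 ^ card B"
    using assms card_spins by auto
  interpret B: real_distribution "spin_sum_law B"
    using assms by (intro real_distribution_spin_sum_law)
  interpret U: prob_space "uniform_count_measure ?PB"
    using fin spins_nonempty by (intro prob_space_uniform_count_measure) auto
  have unif: "uniform_count_measure ?PA \<Otimes>\<^sub>M uniform_count_measure ?PB
      = point_measure (?PA \<times> ?PB) (\<lambda>_. ennreal (1 / 2 ^ (card A + card B)))"
    unfolding uniform_count_measure_def point_measure_def
    using U.sigma_finite_measure_axioms fin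
    by (subst pair_measure_density)
       (auto simp: uniform_count_measure_def point_measure_def pair_measure_count_space cards
          power_add sigma_finite_measure_count_space_finite simp flip: ennreal_mult intro!: density_cong)
  have pair: "spin_sum_law A \<Otimes>\<^sub>M spin_sum_law B =
      distr (uniform_count_measure ?PA \<Otimes>\<^sub>M uniform_count_measure ?PB) (borel \<Otimes>\<^sub>M borel) ?Z"
    using B.sigma_finite_measure_axioms
    unfolding spin_sum_law_def X_def Y_def
    by (intro pair_measure_distr) (auto simp: uniform_count_measure_def)
  have Z: "?Z \<in> measurable (point_measure (?PA \<times> ?PB) (\<lambda>_. ennreal (1 / 2 ^ (card A + card B)))) (borel \<Otimes>\<^sub>M borel)"
    by (simp add: space_pair_measure)
  show "integrable (spin_sum_law A \<Otimes>\<^sub>M spin_sum_law B) F"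
    unfolding pair unif using fin
    by (subst integrable_distr_eq[OF Z]) (auto intro!: integrable_point_measure_finite)
  have "(\<integral>z. F z \<partial>(spin_sum_law A \<Otimes>\<^sub>M spin_sum_law B))
     = (\<Sum>z\<in>?PA \<times> ?PB. (1 / 2 ^ (card A + card B)) * F (?Z z))"
    unfolding pair unif using fin
    by (subst integral_distr[OF Z]) (auto simp: lebesgue_integral_point_measure_finite)
  also have "\<dots> = (\<Sum>\<sigma>\<in>?PA. \<Sum>\<tau>\<in>?PB. F (X \<sigma>, Y \<tau>)) / 2 ^ (card A + card B)"
    by (simp add: sum.cartesian_product sum_divide_distrib split_beta)
  finally show "(\<integral>z. F z \<partial>(spin_sum_law A \<Otimes>\<^sub>M spin_sum_law B)) =
      (\<Sum>\<sigma>\<in>?PA. \<Sum>\<tau>\<in>?PB.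
         F (sqrt (2 / real (card A)) * (\<Sum>i\<in>A. \<sigma> i), sqrt (2 / real (card B)) * (\<Sum>i\<in>B. \<tau> i)))
       / 2 ^ (card A + card B)"
    by (simp add: X_def Y_def)
qed

text \<open>By Fubini the exponential splits into a product of two one-block moments, each at most
  \<open>1 / sqrt (1 - s)\<close>.\<close>

lemma pair_spin_sum_law_exp_square_bound:
  assumes "finite A" "finite B" "0 \<le> s" "s < 1"
  shows "(\<integral>z. exp (s * ((fst z)\<^sup>2 + (snd z)\<^sup>2) / 4) \<partial>(spin_sum_law A \<Otimes>\<^sub>M spin_sum_law B)) \<le> 1 / (1 - s)"
proof -
  interpret A: real_distribution "spin_sum_law A"
    using assms by (intro real_distribution_spin_sum_law)
  interpret B: real_distribution "spin_sum_law B"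
    using assms by (intro real_distribution_spin_sum_law)
  interpret pair_sigma_finite "spin_sum_law A" "spin_sum_law B" ..
  have "(\<integral>z. exp (s * ((fst z)\<^sup>2 + (snd z)\<^sup>2) / 4) \<partial>(spin_sum_law A \<Otimes>\<^sub>M spin_sum_law B))
     = (\<integral>x. \<integral>y. exp (s * (x\<^sup>2 + y\<^sup>2) / 4) \<partial>spin_sum_law B \<partial>spin_sum_law A)"
    using assms by (subst integral_fst'[symmetric]) (auto intro!: pair_spin_sum_law(1))
  also have "\<dots> = (\<integral>x. exp (s * x\<^sup>2 / 4) \<partial>spin_sum_law A) * (\<integral>y. exp (s * y\<^sup>2 / 4) \<partial>spin_sum_law B)"
    by (simp add: distrib_left add_divide_distrib exp_add)
  also have "\<dots> \<le> (1 / sqrt (1 - s)) * (1 / sqrt (1 - s))"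
    using assms by (intro mult_mono spin_sum_law_exp_square_bound) auto
  also have "\<dots> = 1 / (1 - s)" using assms by simp
  finally show ?thesis .
qed

section \<open>Coupling and convergence of integrals over pairs\<close>

text \<open>Skorohod's theorem turns weak convergence into pointwise convergence on a single
  probability space, as \<open>tendsto_integral_bounded_moment\<close> requires.\<close>

lemma spin_sum_law_coupling:
  assumes "\<And>n. finite (A n)" "\<And>n. card (A n) = n"
  obtains \<Omega> :: "real measure" and X X' where "prob_space \<Omega>" "\<And>n. X n \<in> borel_measurable \<Omega>"
    "\<And>n. distr \<Omega> borel (X n) = spin_sum_law (A n)" "X' \<in> borel_measurable \<Omega>"
    "distr \<Omega> borel X' = normal2" "\<And>x. x \<in> space \<Omega> \<Longrightarrow> (\<lambda>n. X n x) \<longlonglongrightarrow> X' x"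
proof -
  obtain \<Omega> :: "real measure" and X X' where *: "prob_space \<Omega>" "\<forall>n. X n \<in> borel_measurable \<Omega>"
    "\<forall>n. distr \<Omega> borel (X n) = spin_sum_law (A n)" "X' \<in> measurable \<Omega> lborel"
    "distr \<Omega> borel X' = normal2" "\<forall>x\<in>space \<Omega>. (\<lambda>n. X n x) \<longlonglongrightarrow> X' x"
    using Skorohod[OF real_distribution_spin_sum_law[OF assms(1)] real_distribution_normal2
        weak_conv_spin_sum_law[OF assms]] by blast
  show thesis by (rule that[of \<Omega> X X']) (use * in auto)
qed

text \<open>Weak convergence extended to unbounded \<open>F\<close>: continuity carries the
  pointwise convergence of the couplings over to \<open>F\<close>, and growth with
  \<open>c < 1\<close> leaves room for a moment of order above 1.\<close>

lemma tendsto_integral_pair_spin_sum_law: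
  fixes F :: "real \<times> real \<Rightarrow> real"
  assumes A: "\<And>n. finite (A n)" "\<And>n. card (A n) = n"
    and B: "\<And>n. finite (B n)" "\<And>n. card (B n) = n"
    and cont: "continuous_on UNIV F"
    and bound: "\<And>z. \<bar>F z\<bar> \<le> C * exp (c * ((fst z)\<^sup>2 + (snd z)\<^sup>2) / 4)"
    and c: "0 < c" "c < 1"
    and int: "integrable (normal2 \<Otimes>\<^sub>M normal2) F"
  shows "(\<lambda>n. \<integral>z. F z \<partial>(spin_sum_law (A n) \<Otimes>\<^sub>M spin_sum_law (B n)))
           \<longlonglongrightarrow> (\<integral>z. F z \<partial>(normal2 \<Otimes>\<^sub>M normal2))"
proof -
  have F [measurable]: "F \<in> borel_measurable (borel \<Otimes>\<^sub>M borel)"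
    using cont by (simp add: borel_prod borel_measurable_continuous_onI)
  obtain \<Omega>1 :: "real measure" and X X' where 1: "prob_space \<Omega>1" "\<And>n. X n \<in> borel_measurable \<Omega>1"
    "\<And>n. distr \<Omega>1 borel (X n) = spin_sum_law (A n)" "X' \<in> borel_measurable \<Omega>1"
    "distr \<Omega>1 borel X' = normal2" "\<And>x. x \<in> space \<Omega>1 \<Longrightarrow> (\<lambda>n. X n x) \<longlonglongrightarrow> X' x"
    using spin_sum_law_coupling[OF A] by metis
  obtain \<Omega>2 :: "real measure" and Y Y' where 2: "prob_space \<Omega>2" "\<And>n. Y n \<in> borel_measurable \<Omega>2"
    "\<And>n. distr \<Omega>2 borel (Y n) = spin_sum_law (B n)" "Y' \<in> borel_measurable \<Omega>2"
    "distr \<Omega>2 borel Y' = normal2" "\<And>x. x \<in> space \<Omega>2 \<Longrightarrow> (\<lambda>n. Y n x) \<longlonglongrightarrow> Y' x"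
    using spin_sum_law_coupling[OF B] by metis
  note [measurable] = 1(2,4) 2(2,4)
  interpret P: prob_space "\<Omega>1 \<Otimes>\<^sub>M \<Omega>2" using 1(1) 2(1) by (rule prob_space_pair)
  \<comment> \<open>Placing the two couplings on separate factors of a product space makes the
    coordinates independent, so their joint law is the product of the laws.\<close>
  have law: "distr \<Omega>1 borel U \<Otimes>\<^sub>M distr \<Omega>2 borel V
     = distr (\<Omega>1 \<Otimes>\<^sub>M \<Omega>2) (borel \<Otimes>\<^sub>M borel) (\<lambda>z. (U (fst z), V (snd z)))"
    if [measurable]: "U \<in> borel_measurable \<Omega>1" "V \<in> borel_measurable \<Omega>2" for U V :: "real \<Rightarrow> real"
  proof -
    interpret V: prob_space "distr \<Omega>2 borel V" using 2(1) that by (intro prob_space.prob_space_distr)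
    show ?thesis
      using V.sigma_finite_measure_axioms by (subst pair_measure_distr) (auto simp: split_beta')
  qed
  note law_n = law[OF 1(2) 2(2), unfolded 1(3) 2(3)]
  note law_lim = law[OF 1(4) 2(4), unfolded 1(5) 2(5)]
  have integral_distr': "(\<integral>z. f z \<partial>distr (\<Omega>1 \<Otimes>\<^sub>M \<Omega>2) (borel \<Otimes>\<^sub>M borel) (\<lambda>z. (U (fst z), V (snd z)))) =
      (\<integral>z. f (U (fst z), V (snd z)) \<partial>(\<Omega>1 \<Otimes>\<^sub>M \<Omega>2))"
    and integrable_distr': "integrable (distr (\<Omega>1 \<Otimes>\<^sub>M \<Omega>2) (borel \<Otimes>\<^sub>M borel) (\<lambda>z. (U (fst z), V (snd z)))) f \<Longrightarrow>
      integrable (\<Omega>1 \<Otimes>\<^sub>M \<Omega>2) (\<lambda>z. f (U (fst z), V (snd z)))"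
    if [measurable]: "U \<in> borel_measurable \<Omega>1" "V \<in> borel_measurable \<Omega>2" "f \<in> borel_measurable (borel \<Otimes>\<^sub>M borel)"
    for U V :: "real \<Rightarrow> real" and f :: "real \<times> real \<Rightarrow> real"
    by (subst integral_distr, simp_all) (subst (asm) integrable_distr_eq, simp_all)
  have C: "C \<ge> 0" using bound[of "(0,0)"] by simp
  \<comment> \<open>Chosen so that \<open>p * c\<close> is the midpoint of \<open>c\<close> and 1:
    then \<open>p > 1\<close>, while the exponential square moment at \<open>s = p * c < 1\<close>
    is still bounded uniformly in \<open>n\<close>.\<close>
  define p where "p = (1 + c) / (2 * c)"
  have p: "p > 1" and pc: "p * c = (1 + c) / 2" using c by (auto simp: p_def field_simps)
  define W where "W = (\<lambda>z::real\<times>real. C powr p * exp ((1 + c) / 2 * ((fst z)\<^sup>2 + (snd z)\<^sup>2) / 4))"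
  have [measurable]: "W \<in> borel_measurable (borel \<Otimes>\<^sub>M borel)" unfolding W_def by measurable
  have FW: "\<bar>F z\<bar> powr p \<le> W z" for z
  proof -
    have "\<bar>F z\<bar> powr p \<le> (C * exp (c * ((fst z)\<^sup>2 + (snd z)\<^sup>2) / 4)) powr p"
      using bound p by (intro powr_mono2) auto
    also have "\<dots> = C powr p * exp (p * c * ((fst z)\<^sup>2 + (snd z)\<^sup>2) / 4)"
      using C by (simp add: powr_mult exp_powr_real mult_ac)
    finally show ?thesis by (simp add: W_def pc)
  qed
  have "(\<lambda>n. \<integral>z. F (X n (fst z), Y n (snd z)) \<partial>(\<Omega>1 \<Otimes>\<^sub>M \<Omega>2))
      \<longlonglongrightarrow> (\<integral>z. F (X' (fst z), Y' (snd z)) \<partial>(\<Omega>1 \<Otimes>\<^sub>M \<Omega>2))"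
  proof (rule P.tendsto_integral_bounded_moment[where p = p and w = "\<lambda>n z. W (X n (fst z), Y n (snd z))" and B = "C powr p * (1 / (1 - (1 + c) / 2))"])
    show "integrable (\<Omega>1 \<Otimes>\<^sub>M \<Omega>2) (\<lambda>z. F (X n (fst z), Y n (snd z)))" for n
      using pair_spin_sum_law(1)[OF A(1) B(1) F] unfolding law_n by (intro integrable_distr') auto
    show "integrable (\<Omega>1 \<Otimes>\<^sub>M \<Omega>2) (\<lambda>z. W (X n (fst z), Y n (snd z)))" for n
      using pair_spin_sum_law(1)[OF A(1) B(1), of W] unfolding law_n by (intro integrable_distr') auto
    show "integrable (\<Omega>1 \<Otimes>\<^sub>M \<Omega>2) (\<lambda>z. F (X' (fst z), Y' (snd z)))"
      using int unfolding law_lim by (intro integrable_distr') auto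
    show "(\<lambda>n. F (X n (fst z), Y n (snd z))) \<longlonglongrightarrow> F (X' (fst z), Y' (snd z))" if "z \<in> space (\<Omega>1 \<Otimes>\<^sub>M \<Omega>2)" for z
      using that 1(6) 2(6)
      by (intro continuous_on_tendsto_compose[OF cont] tendsto_Pair) (auto simp: space_pair_measure)
    show "(\<integral>z. W (X n (fst z), Y n (snd z)) \<partial>(\<Omega>1 \<Otimes>\<^sub>M \<Omega>2)) \<le> C powr p * (1 / (1 - (1 + c) / 2))" for n
    proof -
      have "(\<integral>z. W (X n (fst z), Y n (snd z)) \<partial>(\<Omega>1 \<Otimes>\<^sub>M \<Omega>2)) = (\<integral>z. W z \<partial>(spin_sum_law (A n) \<Otimes>\<^sub>M spin_sum_law (B n)))"
        unfolding law_n by (subst integral_distr') auto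
      also have "\<dots> \<le> C powr p * (1 / (1 - (1 + c) / 2))"
        unfolding W_def integral_mult_right_zero using c A(1) B(1)
        by (intro mult_left_mono pair_spin_sum_law_exp_square_bound) auto
      finally show ?thesis .
    qed
  qed (use p FW in auto)
  then show ?thesis
    unfolding law_n law_lim by (subst (1 2) integral_distr') auto
qed

section \<open>Gibbs expectations as reweighted uniform expectations\<close>

lemma sum_PiE_Un_disjoint:
  fixes D :: "'i \<Rightarrow> 'b::comm_monoid_add set"
  assumes "A \<inter> B = {}"
  shows "(\<Sum>\<sigma>\<in>PiE (A \<union> B) D. G (\<Sum>i\<in>A. \<sigma> i) (\<Sum>i\<in>B. \<sigma> i)) =
    (\<Sum>\<sigma>\<in>PiE A D. \<Sum>\<tau>\<in>PiE B D. G (\<Sum>i\<in>A. \<sigma> i) (\<Sum>i\<in>B. \<tau> i))"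
proof -
  have "(\<Sum>\<sigma>\<in>PiE (A \<union> B) D. G (\<Sum>i\<in>A. \<sigma> i) (\<Sum>i\<in>B. \<sigma> i)) =
     (\<Sum>z\<in>PiE A D \<times> PiE B D. G (\<Sum>i\<in>A. fst z i) (\<Sum>i\<in>B. snd z i))"
    \<comment> \<open>Restriction to the two blocks, inverted by gluing. Outside
      \<open>A \<union> B\<close> the glued function takes the value of \<open>snd z\<close>, which
      is \<open>undefined\<close> there as \<open>PiE\<close> demands.\<close>
    by (rule sum.reindex_bij_witness[where i = "\<lambda>z x. if x \<in> A then fst z x else snd z x"
          and j = "\<lambda>\<sigma>. (restrict \<sigma> A, restrict \<sigma> B)"])
       (use assms in \<open>auto simp: PiE_iff extensional_def restrict_def fun_eq_iff disjoint_iff\<close>)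
  then show ?thesis by (simp add: sum.cartesian_product split_beta)
qed

text \<open>The double sums factor along the blocks. Pairs are ordered, so the mixed product occurs
  twice, turning \<open>\<alpha> / (2 * N)\<close> into \<open>\<alpha> / N\<close>.\<close>

lemma block_H_eq:
  assumes "S \<subseteq> {1..N}"
  shows "- block_H N \<alpha> \<beta> S \<sigma> = \<beta> / (2 * real N) * ((\<Sum>i\<in>S. \<sigma> i)\<^sup>2 + (\<Sum>i\<in>{1..N} - S. \<sigma> i)\<^sup>2)
    + \<alpha> / real N * ((\<Sum>i\<in>S. \<sigma> i) * (\<Sum>i\<in>{1..N} - S. \<sigma> i))"
proof -
  let ?B = "{1..N} - S"
  have split: "(\<Sum>i\<in>{1..N}. h i) = (\<Sum>i\<in>S. h i) + (\<Sum>i\<in>?B. h i)" for h :: "nat \<Rightarrow> real"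
    using assms sum.subset_diff[of S "{1..N}" h] by simp
  have "(\<Sum>i\<in>{1..N}. \<Sum>j\<in>{1..N}. if (i \<in> S \<longleftrightarrow> j \<in> S) then \<sigma> i * \<sigma> j else 0)
    = (\<Sum>i\<in>S. \<sigma> i)\<^sup>2 + (\<Sum>i\<in>?B. \<sigma> i)\<^sup>2"
    unfolding split by (simp add: power2_eq_square sum_product)
  moreover have "(\<Sum>i\<in>{1..N}. \<Sum>j\<in>{1..N}. if (i \<in> S \<longleftrightarrow> j \<in> S) then 0 else \<sigma> i * \<sigma> j)
    = (\<Sum>i\<in>S. \<sigma> i) * (\<Sum>i\<in>?B. \<sigma> i) + (\<Sum>i\<in>?B. \<sigma> i) * (\<Sum>i\<in>S. \<sigma> i)"
    unfolding split by (simp add: sum_product)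
  ultimately show ?thesis
    unfolding block_H_def by (cases "N = 0") (simp_all add: field_simps)
qed

text \<open>The Gibbs weight \<open>exp (- H)\<close> as a function of the limit coordinates
  \<open>z = \<surd>N (m\<^sub>1, m\<^sub>2)\<close>, in which it does not depend on \<open>N\<close>.\<close>
definition tilt :: "real \<Rightarrow> real \<Rightarrow> real \<times> real \<Rightarrow> real" where
  "tilt \<alpha> \<beta> z = exp (\<beta> / 8 * ((fst z)\<^sup>2 + (snd z)\<^sup>2) + \<alpha> / 4 * (fst z * snd z))"

lemma continuous_on_tilt: "continuous_on UNIV (tilt \<alpha> \<beta>)"
  unfolding tilt_def by (intro continuous_intros)

text \<open>The mixed term is absorbed by \<open>2 * x * y \<le> x^2 + y^2\<close>, giving the
  growth bound of \<open>tendsto_integral_pair_spin_sum_law\<close> with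
  \<open>c = (\<alpha> + \<beta>) / 2\<close>.\<close>

lemma tilt_le:
  assumes "\<alpha> \<ge> 0"
  shows "tilt \<alpha> \<beta> z \<le> exp ((\<alpha> + \<beta>) / 2 * ((fst z)\<^sup>2 + (snd z)\<^sup>2) / 4)"
proof -
  have "2 * (fst z * snd z) \<le> (fst z)\<^sup>2 + (snd z)\<^sup>2"
    using sum_squares_bound[of "fst z" "snd z"] by simp
  then have "\<alpha> / 8 * (2 * (fst z * snd z)) \<le> \<alpha> / 8 * ((fst z)\<^sup>2 + (snd z)\<^sup>2)"
    using assms by (intro mult_left_mono) auto
  then show ?thesis by (simp add: tilt_def field_simps)
qed

text \<open>The partition function is the same sum with \<open>f\<close> replaced by 1. The number
  \<open>2 ^ (n + n)\<close> of configurations cancels in the quotient, leaving averages over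
  independent uniform blocks.\<close>

lemma scaled_mag_expect_eq:
  assumes S: "S \<subseteq> {1..2 * n}" "card S = n" and n: "n > 0"
    and [measurable]: "f \<in> borel_measurable (borel \<Otimes>\<^sub>M borel)"
  defines "P \<equiv> spin_sum_law S \<Otimes>\<^sub>M spin_sum_law ({1..2 * n} - S)"
  shows "scaled_mag_expect (2 * n) \<alpha> \<beta> S f =
    (\<integral>z. tilt \<alpha> \<beta> z * f z \<partial>P) / (\<integral>z. tilt \<alpha> \<beta> z \<partial>P)"
proof -
  let ?B = "{1..2 * n} - S"
  let ?s = "sqrt (2 / real n)"
  have fin: "finite S" "finite ?B" using S(1) finite_subset by auto
  have cB: "card ?B = n" using S fin by (simp add: card_Diff_subset)
  have Un: "S \<union> ?B = {1..2 * n}" using S(1) by auto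
  have s2: "?s * ?s = 2 / real n" by simp
  have weight: "exp (- block_H (2 * n) \<alpha> \<beta> S \<sigma>) = tilt \<alpha> \<beta> (?s * (\<Sum>i\<in>S. \<sigma> i), ?s * (\<Sum>i\<in>?B. \<sigma> i))" for \<sigma>
  proof -
    have "?s * a * (?s * b) = 2 / real n * (a * b)" for a b
      using s2 by (metis mult.assoc mult.left_commute)
    \<comment> \<open>With \<open>?s^2 = 2 / n\<close>, the factors \<open>\<beta> / 8\<close> and
      \<open>\<alpha> / 4\<close> become \<open>\<beta> / (4 * n)\<close> and
      \<open>\<alpha> / (2 * n)\<close>, the coefficients of \<open>block_H_eq\<close> at
      \<open>N = 2 * n\<close>.\<close>
    then have "\<beta> / (2 * real (2 * n)) * (a\<^sup>2 + b\<^sup>2) + \<alpha> / real (2 * n) * (a * b) =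
        \<beta> / 8 * ((?s * a)\<^sup>2 + (?s * b)\<^sup>2) + \<alpha> / 4 * (?s * a * (?s * b))" for a b
      unfolding power2_eq_square using n by (simp only:) (simp add: field_simps)
    then show ?thesis
      unfolding tilt_def fst_conv snd_conv block_H_eq[OF S(1)] by simp
  qed
  have mags: "sqrt (real (2 * n)) * mag1 (2 * n) S \<sigma> = ?s * (\<Sum>i\<in>S. \<sigma> i)"
    "sqrt (real (2 * n)) * mag2 (2 * n) S \<sigma> = ?s * (\<Sum>i\<in>?B. \<sigma> i)" for \<sigma>
  proof -
    have "sqrt (real (2 * n)) * (2 / real (2 * n)) = ?s"
      using n by (simp add: real_sqrt_mult real_sqrt_divide field_simps)
    moreover have "{1..2 * n} \<inter> S = S" using S(1) by auto
    ultimately show "sqrt (real (2 * n)) * mag1 (2 * n) S \<sigma> = ?s * (\<Sum>i\<in>S. \<sigma> i)"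
      "sqrt (real (2 * n)) * mag2 (2 * n) S \<sigma> = ?s * (\<Sum>i\<in>?B. \<sigma> i)"
      unfolding mag1_def mag2_def by (metis mult.assoc)+
  qed
  have P: "(\<Sum>\<sigma>\<in>spin_configs (2 * n). g (?s * (\<Sum>i\<in>S. \<sigma> i), ?s * (\<Sum>i\<in>?B. \<sigma> i))) =
     2 ^ (n + n) * (\<integral>z. g z \<partial>P)" if [measurable]: "g \<in> borel_measurable (borel \<Otimes>\<^sub>M borel)" for g :: "real \<times> real \<Rightarrow> real"
  proof -
    have "(\<Sum>\<sigma>\<in>PiE (S \<union> ?B) (\<lambda>_. {-1, 1}). g (?s * (\<Sum>i\<in>S. \<sigma> i), ?s * (\<Sum>i\<in>?B. \<sigma> i))) =
        (\<Sum>\<sigma>\<in>PiE S (\<lambda>_. {-1, 1}). \<Sum>\<tau>\<in>PiE ?B (\<lambda>_. {-1, 1}). g (?s * (\<Sum>i\<in>S. \<sigma> i), ?s * (\<Sum>i\<in>?B. \<tau> i)))"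
      by (rule sum_PiE_Un_disjoint[where G = "\<lambda>a b. g (?s * a, ?s * b)"]) auto
    then show ?thesis
      unfolding P_def pair_spin_sum_law(2)[OF fin that] cB S(2) spin_configs_def Un by simp
  qed
  have [measurable]: "tilt \<alpha> \<beta> \<in> borel_measurable (borel \<Otimes>\<^sub>M borel)"
    using continuous_on_tilt by (simp add: borel_prod borel_measurable_continuous_onI)
  have "scaled_mag_expect (2 * n) \<alpha> \<beta> S f =
     (\<Sum>\<sigma>\<in>spin_configs (2 * n). exp (- block_H (2 * n) \<alpha> \<beta> S \<sigma>) * f (?s * (\<Sum>i\<in>S. \<sigma> i), ?s * (\<Sum>i\<in>?B. \<sigma> i)))
      / (\<Sum>\<sigma>\<in>spin_configs (2 * n). exp (- block_H (2 * n) \<alpha> \<beta> S \<sigma>))"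
    unfolding scaled_mag_expect_def gibbs_def partition_fn_def mags
    by (simp add: sum_divide_distrib)
  also have "\<dots> = (2 ^ (n + n) * (\<integral>z. tilt \<alpha> \<beta> z * f z \<partial>P)) / (2 ^ (n + n) * (\<integral>z. tilt \<alpha> \<beta> z \<partial>P))"
    unfolding weight by (subst (1 2) P[symmetric]) auto
  finally show ?thesis by simp
qed

section \<open>The bivariate Gaussian as a reweighted product normal law\<close>

text \<open>Completing the square in \<open>y\<close> separates the marginal density of
  \<open>x\<close> from the conditional density of \<open>y\<close>, which has mean
  \<open>r * x\<close> and variance \<open>s2 * (1 - r^2)\<close>.\<close>

lemma gauss2_density_factor:
  assumes "s2 > 0" "\<bar>r\<bar> < 1"
  shows "gauss2_density s2 r (x, y) =
    normal_density 0 (sqrt s2) x * normal_density (r * x) (sqrt (s2 * (1 - r\<^sup>2))) y"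
proof -
  have r: "1 - r\<^sup>2 > 0" using assms by (simp add: abs_square_less_1)
  have "(x\<^sup>2 - 2 * r * x * y + y\<^sup>2) = (1 - r\<^sup>2) * x\<^sup>2 + (y - r * x)\<^sup>2"
    by (simp add: power2_eq_square algebra_simps)
  moreover have "- (d * a + b) / (2 * s2 * d) = - a / (2 * s2) + - b / (2 * (s2 * d))" if "d > 0" for a b d
    using that assms by (simp add: field_simps)
  ultimately have "- (x\<^sup>2 - 2 * r * x * y + y\<^sup>2) / (2 * s2 * (1 - r\<^sup>2)) =
     - x\<^sup>2 / (2 * s2) + - (y - r * x)\<^sup>2 / (2 * (s2 * (1 - r\<^sup>2)))"
    using r by metis
  moreover have "sqrt (2 * pi * s2) * sqrt (2 * pi * (s2 * (1 - r\<^sup>2))) = 2 * pi * s2 * sqrt (1 - r\<^sup>2)"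
  proof -
    have "sqrt (2 * pi * s2) * sqrt (2 * pi * (s2 * (1 - r\<^sup>2))) = sqrt (2 * pi * s2) * sqrt (2 * pi * s2) * sqrt (1 - r\<^sup>2)"
      by (simp add: real_sqrt_mult)
    then show ?thesis using assms by (simp add: abs_mult)
  qed
  moreover have "(sqrt s2)\<^sup>2 = s2" "(sqrt (s2 * (1 - r\<^sup>2)))\<^sup>2 = s2 * (1 - r\<^sup>2)"
    using assms r by auto
  ultimately show ?thesis
    unfolding gauss2_density_def normal_density_def case_prod_conv
    by (simp only: exp_add diff_0_right times_divide_times_eq mult_1 times_divide_eq_left times_divide_eq_right divide_divide_eq_left)
qed

lemma gauss2_density_nonneg: "s2 > 0 \<Longrightarrow> \<bar>r\<bar> < 1 \<Longrightarrow> 0 \<le> gauss2_density s2 r z"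
  by (cases z) (simp add: gauss2_density_factor)

lemma measurable_gauss2_density [measurable]: "gauss2_density s2 r \<in> borel_measurable borel"
proof -
  have "gauss2_density s2 r \<in> borel_measurable (borel \<Otimes>\<^sub>M borel)"
    unfolding gauss2_density_def by measurable
  then show ?thesis by (simp add: borel_prod)
qed

text \<open>By Tonelli, integrating out the conditional density of \<open>y\<close> and then the
  marginal of \<open>x\<close> gives mass 1. This makes bounded continuous functions integrable and
  identifies the limit of the normalising constants.\<close>

lemma prob_space_gauss2:
  assumes "s2 > 0" "\<bar>r\<bar> < 1"
  shows "prob_space (gauss2 s2 r)"
proof
  have r: "s2 * (1 - r\<^sup>2) > 0" using assms by (simp add: abs_square_less_1)
  have nd: "(\<integral>\<^sup>+y. ennreal (normal_density \<mu> \<sigma> y) \<partial>lborel) = 1" if "\<sigma> > 0" for \<mu> \<sigma>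
    using that by (simp add: nn_integral_eq_integral)
  have "emeasure (gauss2 s2 r) (space (gauss2 s2 r)) = (\<integral>\<^sup>+z. ennreal (gauss2_density s2 r z) \<partial>lborel)"
    by (simp add: gauss2_def emeasure_density)
  also have "\<dots> = (\<integral>\<^sup>+z. ennreal (gauss2_density s2 r z) \<partial>(lborel \<Otimes>\<^sub>M lborel))"
    by (simp add: lborel_prod)
  also have "\<dots> = (\<integral>\<^sup>+x. \<integral>\<^sup>+y. ennreal (gauss2_density s2 r (x, y)) \<partial>lborel \<partial>lborel)"
    by (rule lborel.nn_integral_fst[symmetric]) (simp add: lborel_prod)
  also have "\<dots> = (\<integral>\<^sup>+x. ennreal (normal_density 0 (sqrt s2) x) * (\<integral>\<^sup>+y. ennreal (normal_density (r * x) (sqrt (s2 * (1 - r\<^sup>2))) y) \<partial>lborel) \<partial>lborel)"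
    unfolding gauss2_density_factor[OF assms] by (simp add: ennreal_mult' nn_integral_cmult)
  also have "\<dots> = 1"
    using assms r by (simp add: nd)
  finally show "emeasure (gauss2 s2 r) (space (gauss2 s2 r)) = 1" .
qed

lemma pair_normal2: "normal2 \<Otimes>\<^sub>M normal2 =
    density lborel (\<lambda>z. ennreal (normal_density 0 (sqrt 2) (fst z) * normal_density 0 (sqrt 2) (snd z)))"
proof -
  interpret real_distribution normal2 by (rule real_distribution_normal2)
  have "normal2 \<Otimes>\<^sub>M normal2 = density (lborel \<Otimes>\<^sub>M lborel)
     (\<lambda>(x, y). ennreal (normal_density 0 (sqrt 2) x) * ennreal (normal_density 0 (sqrt 2) y))"
    by (rule pair_measure_density) (auto intro: sigma_finite_measure_axioms sigma_finite_lborel)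
  then show ?thesis by (simp add: lborel_prod split_beta' ennreal_mult')
qed

text \<open>Reweighting subtracts \<open>1/4\<close> times the matrix with diagonal
  \<open>\<beta>\<close> and off-diagonal \<open>\<alpha>\<close> from the inverse covariance
  \<open>1/2\<close> times the identity. What remains is \<open>1/4\<close> times the matrix with
  diagonal \<open>2 - \<beta>\<close> and off-diagonal \<open>-\<alpha>\<close>; it is positive
  definite as \<open>0 \<le> \<alpha> < 2 - \<beta>\<close>, and its inverse is the covariance given
  by \<open>s2\<close> and \<open>r\<close>.\<close>

lemma tilt_normal2:
  fixes f :: "real \<times> real \<Rightarrow> real"
  assumes ab: "0 \<le> \<alpha>" "\<alpha> < 2 - \<beta>"
    and f: "continuous_on UNIV f" "bounded (range f)"
  defines "s2 \<equiv> (8 - 4 * \<beta>) / ((2 - \<beta>)\<^sup>2 - \<alpha>\<^sup>2)" and "r \<equiv> \<alpha> / (2 - \<beta>)"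
  shows "integrable (normal2 \<Otimes>\<^sub>M normal2) (\<lambda>z. tilt \<alpha> \<beta> z * f z)"
    and "(\<integral>z. tilt \<alpha> \<beta> z * f z \<partial>(normal2 \<Otimes>\<^sub>M normal2)) = s2 * sqrt (1 - r\<^sup>2) / 2 * (\<integral>z. f z \<partial>gauss2 s2 r)"
    and "s2 > 0" "\<bar>r\<bar> < 1"
proof -
  define \<gamma> where "\<gamma> = 2 - \<beta>"
  have \<gamma>: "\<gamma> > 0" "\<alpha> < \<gamma>" using ab by (auto simp: \<gamma>_def)
  have d: "\<gamma>\<^sup>2 - \<alpha>\<^sup>2 > 0" using ab \<gamma> by (simp add: power_strict_mono)
  have s2: "s2 = 4 * \<gamma> / (\<gamma>\<^sup>2 - \<alpha>\<^sup>2)" and r: "r = \<alpha> / \<gamma>"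
    by (simp_all add: s2_def r_def \<gamma>_def)
  show s2_pos: "s2 > 0" and r_less: "\<bar>r\<bar> < 1" using \<gamma> d ab by (auto simp: s2 r)
  have r1: "1 - r\<^sup>2 = (\<gamma>\<^sup>2 - \<alpha>\<^sup>2) / \<gamma>\<^sup>2" using \<gamma> by (simp add: r field_simps)
  \<comment> \<open>The conditional variance collapses to \<open>4 / \<gamma>\<close>, which is what
    makes the two exponents agree in \<open>e\<close>.\<close>
  have sr: "s2 * (1 - r\<^sup>2) = 4 / \<gamma>" unfolding r1 s2 using \<gamma> d by (simp add: field_simps power2_eq_square)
  \<comment> \<open>The ratio of normalising constants: \<open>2 * pi * s2 * sqrt (1 - r^2)\<close>
    for the bivariate density over \<open>4 * pi\<close> for the product of two normal densities of
    variance 2.\<close>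
  define K where "K = s2 * sqrt (1 - r\<^sup>2) / 2"
  have K: "K > 0" using s2_pos r_less by (simp add: K_def abs_square_less_1)
  define \<phi> where "\<phi> = (\<lambda>z. normal_density 0 (sqrt 2) (fst z) * normal_density 0 (sqrt 2) (snd z))"
  have \<phi>: "\<phi> z * tilt \<alpha> \<beta> z = K * gauss2_density s2 r z" for z
  proof -
    obtain x y where z: "z = (x, y)" by (cases z)
    have e: "- x\<^sup>2 / 4 + - y\<^sup>2 / 4 + (\<beta> / 8 * (x\<^sup>2 + y\<^sup>2) + \<alpha> / 4 * (x * y)) =
        - (x\<^sup>2 - 2 * r * x * y + y\<^sup>2) / (2 * s2 * (1 - r\<^sup>2))"
    proof -
      have "2 * s2 * (1 - r\<^sup>2) = 8 / \<gamma>" using sr by simp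
      then show ?thesis
        unfolding r using \<gamma>(1) by (simp add: field_simps) (simp add: \<gamma>_def algebra_simps)
    qed
    have "\<phi> z * tilt \<alpha> \<beta> z = exp (- x\<^sup>2 / 4 + - y\<^sup>2 / 4 + (\<beta> / 8 * (x\<^sup>2 + y\<^sup>2) + \<alpha> / 4 * (x * y))) / (4 * pi)"
      unfolding exp_add by (simp add: \<phi>_def z tilt_def normal_density_def exp_add)
    also have "\<dots> = K * gauss2_density s2 r z"
      unfolding e using K by (auto simp: K_def z gauss2_density_def)
    finally show ?thesis .
  qed
  have [measurable]: "f \<in> borel_measurable borel" "tilt \<alpha> \<beta> \<in> borel_measurable borel"
    using f continuous_on_tilt by (auto intro: borel_measurable_continuous_onI)
  have "\<phi> \<in> borel_measurable (borel \<Otimes>\<^sub>M borel)"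
    unfolding \<phi>_def by measurable
  then have [measurable]: "\<phi> \<in> borel_measurable borel"
    by (simp add: borel_prod)
  interpret G: prob_space "gauss2 s2 r" using s2_pos r_less by (rule prob_space_gauss2)
  obtain C where C: "\<And>z. \<bar>f z\<bar> \<le> C" using f(2) by (auto simp: bounded_iff)
  have "integrable (gauss2 s2 r) f"
    using C by (intro G.integrable_const_bound[of _ C]) (auto simp: gauss2_def)
  then have int: "integrable lborel (\<lambda>z. gauss2_density s2 r z * f z)"
    unfolding gauss2_def using s2_pos r_less by (subst (asm) integrable_density) (auto simp: gauss2_density_nonneg)
  have eq: "\<phi> z * (tilt \<alpha> \<beta> z * f z) = K * (gauss2_density s2 r z * f z)" for z
    using \<phi>[of z] by (simp flip: mult.assoc)
  have pair: "normal2 \<Otimes>\<^sub>M normal2 = density lborel (\<lambda>z. ennreal (\<phi> z))"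
    unfolding \<phi>_def by (rule pair_normal2)
  have \<phi>0: "\<phi> z \<ge> 0" for z by (simp add: \<phi>_def)
  show "integrable (normal2 \<Otimes>\<^sub>M normal2) (\<lambda>z. tilt \<alpha> \<beta> z * f z)"
    unfolding pair using int \<phi>0 by (subst integrable_density) (auto simp: eq)
  have "(\<integral>z. tilt \<alpha> \<beta> z * f z \<partial>(normal2 \<Otimes>\<^sub>M normal2)) = K * (\<integral>z. gauss2_density s2 r z * f z \<partial>lborel)"
    unfolding pair using \<phi>0 by (subst integral_density) (auto simp: eq)
  also have "(\<integral>z. gauss2_density s2 r z * f z \<partial>lborel) = (\<integral>z. f z \<partial>gauss2 s2 r)"
    unfolding gauss2_def using s2_pos r_less by (subst integral_density) (auto simp: gauss2_density_nonneg)
  finally show "(\<integral>z. tilt \<alpha> \<beta> z * f z \<partial>(normal2 \<Otimes>\<^sub>M normal2)) = s2 * sqrt (1 - r\<^sup>2) / 2 * (\<integral>z. f z \<partial>gauss2 s2 r)"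
    by (simp add: K_def)
qed

section \<open>Passage to the limit in the quotient\<close>

theorem theorem1p2:
  fixes \<alpha> \<beta> :: real and S :: "nat \<Rightarrow> nat set"
  assumes "0 \<le> \<alpha>" and "\<alpha> < \<beta>" and "\<alpha> + \<beta> < 2"
    and "\<And>n. S n \<subseteq> {1..2 * n} \<and> card (S n) = n"
  shows "converges_in_distribution
           (\<lambda>n f. scaled_mag_expect (2 * n) \<alpha> \<beta> (S n) f)
           (gauss2 ((8 - 4 * \<beta>) / ((2 - \<beta>)\<^sup>2 - \<alpha>\<^sup>2)) (\<alpha> / (2 - \<beta>)))"
  unfolding converges_in_distribution_def
proof (intro allI impI, elim conjE)
  fix f :: "real \<times> real \<Rightarrow> real"
  assume f: "continuous_on UNIV f" "bounded (range f)"
  define s2 where "s2 = (8 - 4 * \<beta>) / ((2 - \<beta>)\<^sup>2 - \<alpha>\<^sup>2)"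
  define r where "r = \<alpha> / (2 - \<beta>)"
  let ?B = "\<lambda>n. {1..2 * n} - S n"
  let ?P = "\<lambda>n. spin_sum_law (S n) \<Otimes>\<^sub>M spin_sum_law (?B n)"
  define K where "K = s2 * sqrt (1 - r\<^sup>2) / 2"
  have ab: "\<alpha> < 2 - \<beta>" using assms by simp
  note tilt = tilt_normal2[OF assms(1) ab, folded s2_def r_def, folded K_def]
  have s2: "s2 > 0" "\<bar>r\<bar> < 1" using tilt(3,4)[OF f] by auto
  have "r\<^sup>2 < 1" using s2 by (simp add: abs_square_less_1)
  then have K: "K \<noteq> 0" using s2 by (simp add: K_def)
  interpret G: prob_space "gauss2 s2 r" using s2 by (rule prob_space_gauss2)
  have S: "finite (S n)" "card (S n) = n" "finite (?B n)" "card (?B n) = n" for n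
    using assms(4)[of n] finite_subset[of "S n" "{1..2 * n}"] by (auto simp: card_Diff_subset)
  have lim: "(\<lambda>n. \<integral>z. tilt \<alpha> \<beta> z * g z \<partial>?P n) \<longlonglongrightarrow> K * (\<integral>z. g z \<partial>gauss2 s2 r)"
    if g: "continuous_on UNIV g" "bounded (range g)" for g :: "real \<times> real \<Rightarrow> real"
  proof -
    obtain C where C: "\<And>z. \<bar>g z\<bar> \<le> C" using g(2) by (auto simp: bounded_iff)
    have "\<bar>tilt \<alpha> \<beta> z * g z\<bar> \<le> C * exp ((\<alpha> + \<beta>) / 2 * ((fst z)\<^sup>2 + (snd z)\<^sup>2) / 4)" for z
    proof -
      have "\<bar>tilt \<alpha> \<beta> z * g z\<bar> = \<bar>g z\<bar> * tilt \<alpha> \<beta> z" by (simp add: abs_mult tilt_def)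
      also have "\<dots> \<le> C * exp ((\<alpha> + \<beta>) / 2 * ((fst z)\<^sup>2 + (snd z)\<^sup>2) / 4)"
        using C[of z] by (intro mult_mono tilt_le assms(1)) (auto simp: tilt_def)
      finally show ?thesis .
    qed
    \<comment> \<open>Here \<open>c = (\<alpha> + \<beta>) / 2\<close> is positive by
      \<open>0 \<le> \<alpha> < \<beta>\<close> and below 1 by
      \<open>\<alpha> + \<beta> < 2\<close>.\<close>
    then have "(\<lambda>n. \<integral>z. tilt \<alpha> \<beta> z * g z \<partial>?P n) \<longlonglongrightarrow> (\<integral>z. tilt \<alpha> \<beta> z * g z \<partial>(normal2 \<Otimes>\<^sub>M normal2))"
      using assms S g tilt(1)[OF g]
      by (intro tendsto_integral_pair_spin_sum_law[where C = C and c = "(\<alpha> + \<beta>) / 2"] continuous_on_mult continuous_on_tilt) auto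
    then show ?thesis unfolding tilt(2)[OF g] .
  qed
  \<comment> \<open>\<open>lim\<close> is used for \<open>f\<close> and for the constant 1, the
    latter giving the normalising constant; the common factor \<open>K\<close> is nonzero and
    cancels.\<close>
  have "(\<lambda>n. (\<integral>z. tilt \<alpha> \<beta> z * f z \<partial>?P n) / (\<integral>z. tilt \<alpha> \<beta> z * 1 \<partial>?P n))
     \<longlonglongrightarrow> (K * (\<integral>z. f z \<partial>gauss2 s2 r)) / (K * (\<integral>z. 1 \<partial>gauss2 s2 r))"
    using K by (intro tendsto_divide lim f) (auto simp: G.prob_space)
  then have "(\<lambda>n. (\<integral>z. tilt \<alpha> \<beta> z * f z \<partial>?P n) / (\<integral>z. tilt \<alpha> \<beta> z \<partial>?P n)) \<longlonglongrightarrow> (\<integral>z. f z \<partial>gauss2 s2 r)"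
    using K by (simp add: G.prob_space)
  \<comment> \<open>The identification with the Gibbs expectation is made for \<open>n > 0\<close>,
    hence only eventually.\<close>
  moreover have "\<forall>\<^sub>F n in sequentially. (\<integral>z. tilt \<alpha> \<beta> z * f z \<partial>?P n) / (\<integral>z. tilt \<alpha> \<beta> z \<partial>?P n)
      = scaled_mag_expect (2 * n) \<alpha> \<beta> (S n) f"
    using eventually_gt_at_top[of 0]
  proof eventually_elim
    case (elim n)
    then show ?case using assms(4)[of n] f(1)
      by (intro scaled_mag_expect_eq[symmetric]) (auto simp: borel_prod borel_measurable_continuous_onI)
  qed
  ultimately have "(\<lambda>n. scaled_mag_expect (2 * n) \<alpha> \<beta> (S n) f) \<longlonglongrightarrow> (\<integral>z. f z \<partial>gauss2 s2 r)"
    by (rule Lim_transform_eventually)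
  then show "(\<lambda>n. scaled_mag_expect (2 * n) \<alpha> \<beta> (S n) f) \<longlonglongrightarrow>
      integral\<^sup>L (gauss2 ((8 - 4 * \<beta>) / ((2 - \<beta>)\<^sup>2 - \<alpha>\<^sup>2)) (\<alpha> / (2 - \<beta>))) f"
    by (simp add: s2_def r_def)
qed

end
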